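(* Let $G$ be an unmixed bipartite graph. Then for every $s\geq 1$ and every $s$-fold product $e_1\cdots e_s$ of edges of $G$ (not necessarily distinct), the graph $G'$ associated to $(I(G)^{s+1} : e_1\cdots e_s)$ is an unmixed bipartite graph.
   Context: Graphs are finite, simple and undirected. For a graph $G$ with vertex set $\{x_1,\ldots,x_n\}$ and a field $k$, the edge ideal is $I(G) = (x_ix_j \mid \{x_i,x_j\}\in E(G)) \subseteq k[x_1,\ldots,x_n]$. An edge $e=\{x_i,x_j\}$ is identified with the monomial $x_ix_j$. For $G$ bipartite, by a theorem of Alilooee and Banerjee, $(I(G)^{s+1}:e_1\cdots e_s)$ is a quadratic squarefree monomial ideal, hence the edge ideal of a graph $G'$ on the vertex set $V(G)$ ("the graph associated to" this ideal). A vertex cover of a graph is a set of vertices meeting every edge; it is minimal if it is minimal with respect to inclusion. A graph is unmixed (well-covered) if all its minimal vertex covers have the same number of elements. *)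

theory Defs
  imports Complex_Main "HOL-Library.Poly_Mapping"
begin

text \<open>
  A graph is given by its set of edges; its vertex set is the whole (finite) type \<open>'v\<close>,
  which also indexes the variables of the polynomial ring. Isolated vertices are thus allowed.
\<close>

type_synonym 'v graph = "'v set set"

definition simple_graph :: "'v graph \<Rightarrow> bool" where
  "simple_graph E \<longleftrightarrow> (\<forall>e\<in>E. card e = 2)"

definition bipartite :: "'v graph \<Rightarrow> bool" where
  "bipartite E \<longleftrightarrow>
     (\<exists>X Y. X \<union> Y = UNIV \<and> X \<inter> Y = {} \<and> (\<forall>e\<in>E. \<exists>x\<in>X. \<exists>y\<in>Y. e = {x, y}))"

definition vertex_cover :: "'v graph \<Rightarrow> 'v set \<Rightarrow> bool" where
  "vertex_cover E C \<longleftrightarrow> (\<forall>e\<in>E. e \<inter> C \<noteq> {})"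

definition minimal_vertex_cover :: "'v graph \<Rightarrow> 'v set \<Rightarrow> bool" where
  "minimal_vertex_cover E C \<longleftrightarrow> vertex_cover E C \<and> (\<forall>D. vertex_cover E D \<and> D \<subseteq> C \<longrightarrow> D = C)"

definition unmixed :: "'v graph \<Rightarrow> bool" where
  "unmixed E \<longleftrightarrow>
     (\<forall>C D. minimal_vertex_cover E C \<and> minimal_vertex_cover E D \<longrightarrow> card C = card D)"

text \<open>
  The polynomial ring \<open>k[x\<^sub>v | v]\<close>: finitely supported maps from exponent vectors to
  coefficients, with convolution as multiplication.
\<close>

type_synonym ('v, 'k) polynomial = "('v \<Rightarrow>\<^sub>0 nat) \<Rightarrow>\<^sub>0 'k"

definition variable :: "'v \<Rightarrow> ('v, 'k::comm_ring_1) polynomial" where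
  "variable v = Poly_Mapping.single (Poly_Mapping.single v 1) 1"

definition edge_monomial :: "'v set \<Rightarrow> ('v, 'k::comm_ring_1) polynomial" where
  "edge_monomial e = (\<Prod>v\<in>e. variable v)"

text \<open>
  The ideals of a commutative ring are its submodules as a module over itself, so the ideal
  generated by a set is its linear span with respect to the ring multiplication.
\<close>

definition generated_ideal :: "'a::comm_ring_1 set \<Rightarrow> 'a set" where
  "generated_ideal S = module.span (*) S"

definition ideal_power :: "'a::comm_ring_1 set \<Rightarrow> nat \<Rightarrow> 'a set" where
  "ideal_power I n = generated_ideal {\<Prod>i<n. f i | f. \<forall>i<n. f i \<in> I}"

definition colon_ideal :: "'a::comm_ring_1 set \<Rightarrow> 'a \<Rightarrow> 'a set" where
  "colon_ideal J a = {b. b * a \<in> J}"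

definition edge_ideal :: "'v graph \<Rightarrow> ('v, 'k::comm_ring_1) polynomial set" where
  "edge_ideal E = generated_ideal (edge_monomial ` E)"

definition associated_graph :: "('v, 'k::comm_ring_1) polynomial set \<Rightarrow> 'v graph \<Rightarrow> bool" where
  "associated_graph J E \<longleftrightarrow> simple_graph E \<and> edge_ideal E = J"

end

theory Submission
  imports Defs
begin

text \<open>
  Fix a bipartition \<open>X\<close>, \<open>Y\<close> of \<open>G\<close>, and call a vertex cover of \<open>G\<close> exact if it contains exactly
  one endpoint of every \<open>e\<^sub>i\<close>. Let \<open>D\<close> be the digraph with an arc \<open>x \<rightarrow> y\<close> for every edge \<open>xy\<close> of
  \<open>G\<close> (\<open>x \<in> X\<close>, \<open>y \<in> Y\<close>) and a reverse arc \<open>y \<rightarrow> x\<close> whenever \<open>xy\<close> is one of the \<open>e\<^sub>i\<close>. A set \<open>C\<close>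
  is an exact cover if and only if \<open>(X - C) \<union> (Y \<inter> C)\<close> is closed under the arcs of \<open>D\<close>. Let \<open>G'\<close>
  consist of the edges \<open>xy\<close> such that \<open>D\<close> has a path from \<open>x\<close> to \<open>y\<close>; it is bipartite with the
  same parts.

  The closed sets of a digraph are governed by reachability, so a set of vertices contains an edge
  of \<open>G'\<close> if and only if it meets every exact cover (\<open>exact_cover_meets_connected\<close>,
  \<open>exact_cover_avoiding\<close>). In particular every vertex cover of \<open>G'\<close> contains an exact cover, and
  exact covers are vertex covers of \<open>G'\<close>.

  \<^item> The colon ideal is contained in \<open>I(G')\<close>: give each variable in a fixed exact cover \<open>C\<close> weight
    \<open>1\<close> and every other variable weight \<open>0\<close>. All monomials in \<open>I(G)\<^bsup>s+1\<^esup>\<close> have weight at least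
    \<open>s + 1\<close>, whereas \<open>e\<^sub>1 \<cdots> e\<^sub>s\<close> has weight exactly \<open>s\<close>. Hence every monomial of a polynomial in the
    colon ideal is divisible by a variable from each exact cover, and therefore by an edge of \<open>G'\<close>.

  \<^item> \<open>I(G')\<close> is contained in the colon ideal: along a path from \<open>x\<close> to \<open>y\<close> in \<open>D\<close> that uses every
    reverse arc at most once, the edges \<open>e\<^sub>i\<close> that are traversed backwards can be exchanged for the
    edges of \<open>G\<close> that are traversed forwards, of which there is one more
    (\<open>connected_times_edges_in_products\<close>).

  For unmixedness, a minimal vertex cover \<open>C\<close> of \<open>G'\<close> is an exact cover. If \<open>C\<close> contains a vertex
  cover \<open>B\<close> of \<open>G\<close>, then \<open>B\<close> meets every \<open>e\<^sub>i\<close> at least once, and at most once as part of \<open>C\<close>, so \<open>B\<close>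
  is itself exact, thus a vertex cover of \<open>G'\<close>, thus equal to \<open>C\<close>. So the minimal vertex covers of
  \<open>G'\<close> are among those of \<open>G\<close>.
\<close>

section \<open>Generated ideals\<close>

lemma module_ring_mult: "module ((*) :: 'a::comm_ring_1 \<Rightarrow> 'a \<Rightarrow> 'a)"
  by unfold_locales (auto simp: algebra_simps)

lemma generated_ideal_minimal:
  fixes S T :: "'a::comm_ring_1 set"
  assumes "S \<subseteq> T" "0 \<in> T" "\<And>p q. p \<in> T \<Longrightarrow> q \<in> T \<Longrightarrow> p + q \<in> T" "\<And>c p. p \<in> T \<Longrightarrow> c * p \<in> T"
  shows "generated_ideal S \<subseteq> T"
  unfolding generated_ideal_def
  by (intro module.span_minimal[OF module_ring_mult] module.subspaceI[OF module_ring_mult] assms)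

lemma generated_ideal_base: "p \<in> S \<Longrightarrow> p \<in> generated_ideal S"
  unfolding generated_ideal_def by (rule module.span_base[OF module_ring_mult])

lemma generated_ideal_zero: "0 \<in> generated_ideal S"
  unfolding generated_ideal_def by (rule module.span_zero[OF module_ring_mult])

lemma generated_ideal_add:
  "p \<in> generated_ideal S \<Longrightarrow> q \<in> generated_ideal S \<Longrightarrow> p + q \<in> generated_ideal S"
  unfolding generated_ideal_def by (rule module.span_add[OF module_ring_mult])

lemma generated_ideal_mult: "p \<in> generated_ideal S \<Longrightarrow> c * p \<in> generated_ideal S"
  unfolding generated_ideal_def by (rule module.span_scale[OF module_ring_mult])

lemma generated_ideal_sum:
  "(\<And>i. i \<in> A \<Longrightarrow> f i \<in> generated_ideal S) \<Longrightarrow> sum f A \<in> generated_ideal S"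
  by (induction A rule: infinite_finite_induct)
    (auto intro: generated_ideal_zero generated_ideal_add)

definition products :: "'a::comm_monoid_mult set \<Rightarrow> nat \<Rightarrow> 'a set" where
  "products M n = {\<Prod>i<n. f i | f. \<forall>i<n. f i \<in> M}"

lemma one_in_products: "1 \<in> products M 0"
  by (auto simp: products_def)

lemma mult_in_products:
  assumes "p \<in> M" "q \<in> products M n"
  shows "p * q \<in> products M (Suc n)"
proof -
  obtain f where f: "q = (\<Prod>i<n. f i)" "\<forall>i<n. f i \<in> M"
    using assms(2) by (auto simp: products_def)
  have "p * q = (\<Prod>i<Suc n. (f(n := p)) i)" "\<forall>i<Suc n. (f(n := p)) i \<in> M"
    using f assms(1) by (auto simp: mult.commute less_Suc_eq)
  then show ?thesis
    unfolding products_def by blast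
qed

lemma prod_in_products:
  assumes "finite I" "\<And>i. i \<in> I \<Longrightarrow> f i \<in> M"
  shows "prod f I \<in> products M (card I)"
  using assms by (induction I rule: finite_induct) (auto intro: one_in_products mult_in_products)

lemma products_mono: "M \<subseteq> N \<Longrightarrow> products M n \<subseteq> products N n"
  by (force simp: products_def)

lemma ideal_power_alt: "ideal_power I n = generated_ideal (products I n)"
  by (simp add: ideal_power_def products_def)

section \<open>Monomials and edge ideals\<close>

definition edge_exponent :: "'v set \<Rightarrow> ('v \<Rightarrow>\<^sub>0 nat)" where
  "edge_exponent e = (\<Sum>v\<in>e. Poly_Mapping.single v 1)"

lemma prod_single:
  "(\<Prod>i\<in>A. Poly_Mapping.single (f i) (1::'k::comm_ring_1)) = Poly_Mapping.single (\<Sum>i\<in>A. f i) 1"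
  by (induction A rule: infinite_finite_induct) (auto simp: mult_single)

lemma edge_monomial_eq_single: "edge_monomial e = Poly_Mapping.single (edge_exponent e) 1"
  by (simp add: edge_monomial_def variable_def edge_exponent_def prod_single)

lemma lookup_edge_exponent:
  "Poly_Mapping.lookup (edge_exponent e) v = (if v \<in> e then 1 else 0)" for e :: "'v::finite set"
  by (simp add: edge_exponent_def lookup_sum lookup_single when_def)

lemma poly_eq_sum_monomials:
  "p = (\<Sum>t\<in>Poly_Mapping.keys p. Poly_Mapping.single t (Poly_Mapping.lookup p t))"
  by (rule poly_mapping_eqI) (auto simp: lookup_sum lookup_single when_def in_keys_iff)

lemma keys_mult_monomial:
  fixes p :: "('v, 'k::comm_ring_1) polynomial"
  assumes "t \<in> Poly_Mapping.keys p"
  shows "t + u \<in> Poly_Mapping.keys (p * Poly_Mapping.single u 1)"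
proof -
  have "p * Poly_Mapping.single u 1
      = (\<Sum>r\<in>Poly_Mapping.keys p. Poly_Mapping.single r (Poly_Mapping.lookup p r)) * Poly_Mapping.single u 1"
    by (simp flip: poly_eq_sum_monomials)
  also have "\<dots> = (\<Sum>r\<in>Poly_Mapping.keys p. Poly_Mapping.single (r + u) (Poly_Mapping.lookup p r))"
    by (simp add: sum_distrib_right mult_single)
  finally have "Poly_Mapping.lookup (p * Poly_Mapping.single u 1) (t + u) = Poly_Mapping.lookup p t"
    using assms by (simp add: lookup_sum lookup_single when_def)
  then show ?thesis
    using assms by (simp add: in_keys_iff)
qed

lemma mem_edge_ideal_iff:
  fixes E :: "'v::finite graph" and p :: "('v, 'k::comm_ring_1) polynomial"
  shows "p \<in> edge_ideal E \<longleftrightarrow> (\<forall>t\<in>Poly_Mapping.keys p. \<exists>e\<in>E. e \<subseteq> Poly_Mapping.keys t)"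
proof
  let ?T = "{p :: ('v, 'k) polynomial. \<forall>t\<in>Poly_Mapping.keys p. \<exists>e\<in>E. e \<subseteq> Poly_Mapping.keys t}"
  have "edge_ideal E \<subseteq> ?T"
    unfolding edge_ideal_def
  proof (rule generated_ideal_minimal)
    show "edge_monomial ` E \<subseteq> ?T"
      by (force simp: edge_monomial_eq_single in_keys_iff lookup_edge_exponent)
  next
    fix p q :: "('v, 'k) polynomial"
    assume "p \<in> ?T" "q \<in> ?T"
    then show "p + q \<in> ?T"
      using keys_add[of p q] by blast
  next
    fix c p :: "('v, 'k) polynomial"
    assume p: "p \<in> ?T"
    show "c * p \<in> ?T"
    proof clarify
      fix t assume "t \<in> Poly_Mapping.keys (c * p)"
      then obtain a b where t: "t = a + b" "b \<in> Poly_Mapping.keys p"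
        using keys_mult[of c p] by blast
      obtain e where "e \<in> E" "e \<subseteq> Poly_Mapping.keys b"
        using p t(2) by auto
      moreover have "Poly_Mapping.keys b \<subseteq> Poly_Mapping.keys (a + b)"
        by (auto simp: in_keys_iff lookup_add)
      ultimately show "\<exists>e\<in>E. e \<subseteq> Poly_Mapping.keys t"
        using t(1) by auto
    qed
  qed simp
  moreover assume "p \<in> edge_ideal E"
  ultimately have "p \<in> ?T"
    by (rule subsetD)
  then show "\<forall>t\<in>Poly_Mapping.keys p. \<exists>e\<in>E. e \<subseteq> Poly_Mapping.keys t"
    by simp
next
  assume *: "\<forall>t\<in>Poly_Mapping.keys p. \<exists>e\<in>E. e \<subseteq> Poly_Mapping.keys t"
  have "Poly_Mapping.single t (Poly_Mapping.lookup p t) \<in> edge_ideal E" if t: "t \<in> Poly_Mapping.keys p" for t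
  proof -
    obtain e where e: "e \<in> E" "e \<subseteq> Poly_Mapping.keys t"
      using bspec[OF * t] by blast
    have split: "t = (t - edge_exponent e) + edge_exponent e"
      using e(2) by (intro poly_mapping_eqI)
        (auto simp: lookup_add lookup_minus lookup_edge_exponent in_keys_iff)
    have "Poly_Mapping.single t (Poly_Mapping.lookup p t)
        = Poly_Mapping.single (t - edge_exponent e) (Poly_Mapping.lookup p t) * edge_monomial e"
      by (subst split) (simp add: edge_monomial_eq_single mult_single)
    then show ?thesis
      unfolding edge_ideal_def using e(1) by (auto intro: generated_ideal_mult generated_ideal_base)
  qed
  then show "p \<in> edge_ideal E"
    unfolding edge_ideal_def by (subst poly_eq_sum_monomials[of p]) (rule generated_ideal_sum)
qed

text \<open>
  The edges of a simple graph form an antichain of sets, so they are the minimal supports of the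
  monomials in its edge ideal.
\<close>

lemma simple_graph_mono_edge_ideal:
  fixes E F :: "'v::finite graph"
  assumes "simple_graph E" "simple_graph F"
    and sub: "(edge_ideal E :: ('v, 'k::comm_ring_1) polynomial set) \<subseteq> edge_ideal F"
  shows "E \<subseteq> F"
proof
  fix e assume e: "e \<in> E"
  let ?m = "edge_monomial e :: ('v, 'k) polynomial"
  have "?m \<in> edge_ideal F"
    using e sub by (auto simp: edge_ideal_def intro: generated_ideal_base)
  then obtain f where f: "f \<in> F" "f \<subseteq> Poly_Mapping.keys (edge_exponent e)"
    by (auto simp: mem_edge_ideal_iff edge_monomial_eq_single)
  have "f \<subseteq> e"
    using f(2) by (auto simp: in_keys_iff lookup_edge_exponent split: if_splits)
  moreover have "card f = card e"
    using assms(1,2) e f(1) by (simp add: simple_graph_def)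
  ultimately have "f = e"
    by (simp add: card_subset_eq)
  then show "e \<in> F"
    using f(1) by simp
qed

lemma edge_ideal_inject:
  fixes E F :: "'v::finite graph"
  assumes "simple_graph E" "simple_graph F"
    and "(edge_ideal E :: ('v, 'k::comm_ring_1) polynomial set) = edge_ideal F"
  shows "E = F"
  using simple_graph_mono_edge_ideal[where 'k = 'k] assms by (metis subset_antisym order_refl)

section \<open>Weights with respect to a set of vertices\<close>

definition weight :: "'v set \<Rightarrow> ('v \<Rightarrow>\<^sub>0 nat) \<Rightarrow> nat" where
  "weight C t = (\<Sum>v\<in>C. Poly_Mapping.lookup t v)"

lemma weight_add: "weight C (s + t) = weight C s + weight C t"
  by (simp add: weight_def lookup_add sum.distrib)

lemma weight_sum: "weight C (\<Sum>i\<in>A. f i) = (\<Sum>i\<in>A. weight C (f i))"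
  by (induction A rule: infinite_finite_induct) (auto simp: weight_add, auto simp: weight_def)

lemma weight_edge_exponent: "weight C (edge_exponent e) = card (e \<inter> C)" for C :: "'v::finite set"
  by (simp add: weight_def lookup_edge_exponent sum.If_cases Int_commute)

text \<open>
  This is the \<open>n\<close>-th power of the ideal generated by the variables in \<open>C\<close>, described by
  its monomials.
\<close>

definition weight_at_least :: "'v set \<Rightarrow> nat \<Rightarrow> ('v, 'k::comm_ring_1) polynomial set" where
  "weight_at_least C n = {p. \<forall>t\<in>Poly_Mapping.keys p. n \<le> weight C t}"

lemma weight_at_least_mult:
  assumes "p \<in> weight_at_least C m" "q \<in> weight_at_least C n"
  shows "p * q \<in> weight_at_least C (m + n)"
  unfolding weight_at_least_def
proof clarify
  fix t assume "t \<in> Poly_Mapping.keys (p * q)"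
  then obtain a b where "t = a + b" "a \<in> Poly_Mapping.keys p" "b \<in> Poly_Mapping.keys q"
    using keys_mult[of p q] by blast
  then show "m + n \<le> weight C t"
    using assms by (auto simp: weight_at_least_def weight_add intro: add_mono)
qed

lemma generated_ideal_weight_at_least:
  assumes "S \<subseteq> weight_at_least C n"
  shows "generated_ideal S \<subseteq> weight_at_least C n"
proof (rule generated_ideal_minimal[OF assms])
  show "0 \<in> weight_at_least C n"
    by (simp add: weight_at_least_def)
next
  fix p q :: "('a, 'b) polynomial"
  assume "p \<in> weight_at_least C n" "q \<in> weight_at_least C n"
  then show "p + q \<in> weight_at_least C n"
    using keys_add[of p q] unfolding weight_at_least_def by blast
next
  fix c p :: "('a, 'b) polynomial"
  assume "p \<in> weight_at_least C n"
  moreover have "c \<in> weight_at_least C 0"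
    by (simp add: weight_at_least_def)
  ultimately show "c * p \<in> weight_at_least C n"
    using weight_at_least_mult by fastforce
qed

lemma products_weight_at_least:
  assumes "M \<subseteq> weight_at_least C 1"
  shows "products M n \<subseteq> weight_at_least C n"
proof -
  have "(\<Prod>i<n. f i) \<in> weight_at_least C n" if "\<forall>i<n. f i \<in> M" for f
    using that
  proof (induction n)
    case 0
    show ?case by (simp add: weight_at_least_def)
  next
    case (Suc n)
    then have "(\<Prod>i<n. f i) \<in> weight_at_least C n" "f n \<in> weight_at_least C 1"
      using assms by auto
    then show ?case
      using weight_at_least_mult by fastforce
  qed
  then show ?thesis
    unfolding products_def by blast
qed

lemma ideal_power_edge_ideal_weight_at_least:
  fixes G :: "'v::finite graph"
  assumes "vertex_cover G C"
  shows "ideal_power (edge_ideal G) n \<subseteq> (weight_at_least C n :: ('v, 'k::comm_ring_1) polynomial set)"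
proof -
  have "edge_monomial ` G \<subseteq> (weight_at_least C 1 :: ('v, 'k) polynomial set)"
    using assms by (auto simp: vertex_cover_def weight_at_least_def edge_monomial_eq_single
        weight_edge_exponent Suc_le_eq card_gt_0_iff)
  then show ?thesis
    unfolding ideal_power_alt edge_ideal_def
    by (intro generated_ideal_weight_at_least products_weight_at_least)
qed

section \<open>Exact covers and reachability\<close>

definition bipartition :: "'v set \<Rightarrow> 'v set \<Rightarrow> 'v graph \<Rightarrow> bool" where
  "bipartition X Y G \<longleftrightarrow>
     X \<union> Y = UNIV \<and> X \<inter> Y = {} \<and> (\<forall>e\<in>G. \<exists>x\<in>X. \<exists>y\<in>Y. e = {x, y})"

definition exact_cover :: "'v graph \<Rightarrow> 'v graph \<Rightarrow> 'v set \<Rightarrow> bool" where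
  "exact_cover G H C \<longleftrightarrow> vertex_cover G C \<and> (\<forall>e\<in>H. card (e \<inter> C) = 1)"

text \<open>
  An arc \<open>u \<rightarrow> v\<close> records an implication valid for all exact covers \<open>C\<close>, where a vertex of \<open>X\<close>
  stands for the statement that it is not in \<open>C\<close>, and a vertex of \<open>Y\<close> for the statement that it is:
  an edge of \<open>G\<close> that \<open>C\<close> misses on the left must be covered on the right, and an edge of \<open>H\<close> that
  is covered on the right must be missed on the left.
\<close>

definition arcs :: "'v set \<Rightarrow> 'v set \<Rightarrow> 'v graph \<Rightarrow> 'v graph \<Rightarrow> ('v \<times> 'v) set" where
  "arcs X Y G H = {(x, y). x \<in> X \<and> y \<in> Y \<and> {x, y} \<in> G} \<union> {(y, x). x \<in> X \<and> y \<in> Y \<and> {x, y} \<in> H}"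

definition connected_graph :: "'v set \<Rightarrow> 'v set \<Rightarrow> 'v graph \<Rightarrow> 'v graph \<Rightarrow> 'v graph" where
  "connected_graph X Y G H = {{x, y} | x y. x \<in> X \<and> y \<in> Y \<and> (x, y) \<in> (arcs X Y G H)\<^sup>*}"

lemma bipartition_connected_graph:
  "bipartition X Y G \<Longrightarrow> bipartition X Y (connected_graph X Y G H)"
  by (auto simp: bipartition_def connected_graph_def)

lemma bipartition_imp_simple_graph:
  assumes "bipartition X Y G"
  shows "simple_graph G"
  unfolding simple_graph_def
proof
  have disj: "X \<inter> Y = {}" and edge: "\<forall>e\<in>G. \<exists>x\<in>X. \<exists>y\<in>Y. e = {x, y}"
    using assms by (simp_all add: bipartition_def)
  fix e assume "e \<in> G"
  with edge obtain x y where "x \<in> X" "y \<in> Y" "e = {x, y}"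
    by (meson bspec)
  then show "card e = 2"
    using disj by (auto simp: card_insert_if)
qed

lemma exact_cover_meets_connected:
  assumes bip: "bipartition X Y G" and C: "exact_cover G H C"
  shows "vertex_cover (connected_graph X Y G H) C"
  unfolding vertex_cover_def
proof
  fix e assume "e \<in> connected_graph X Y G H"
  then obtain x y where e: "e = {x, y}" "x \<in> X" "y \<in> Y" "(x, y) \<in> (arcs X Y G H)\<^sup>*"
    by (auto simp: connected_graph_def)
  have disj: "X \<inter> Y = {}"
    using bip by (simp add: bipartition_def)
  have "(y \<in> X \<longrightarrow> y \<notin> C) \<and> (y \<in> Y \<longrightarrow> y \<in> C)" if "x \<notin> C"
    using e(4)
  proof (induction rule: rtrancl_induct)
    case base
    then show ?case
      using that e(2) disj by auto
  next
    case (step u v)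
    from step.hyps(2) consider
      "u \<in> X" "v \<in> Y" "{u, v} \<in> G" | "v \<in> X" "u \<in> Y" "{v, u} \<in> H"
      by (auto simp: arcs_def)
    then show ?case
    proof cases
      case 1
      then have "{u, v} \<inter> C \<noteq> {}"
        using C unfolding exact_cover_def vertex_cover_def by blast
      then show ?thesis
        using 1 step.IH disj by auto
    next
      case 2
      then have "u \<in> C" "card ({v, u} \<inter> C) = 1" "v \<noteq> u"
        using C step.IH disj unfolding exact_cover_def by auto
      then have "v \<notin> C"
        by auto
      then show ?thesis
        using 2 disj by auto
    qed
  qed
  then show "e \<inter> C \<noteq> {}"
    using e by auto
qed

text \<open>
  The exact cover corresponds to the smallest set of vertices that contains \<open>S \<inter> X\<close> and is closed
  under the arcs. Its vertices in \<open>Y\<close> are those reachable from \<open>S \<inter> X\<close>, and none of them lies in \<open>S\<close>.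
\<close>

lemma exact_cover_avoiding:
  assumes bip: "bipartition X Y G" and HG: "H \<subseteq> G"
    and S: "\<And>e. e \<in> connected_graph X Y G H \<Longrightarrow> \<not> e \<subseteq> S"
  obtains C where "exact_cover G H C" "C \<inter> S = {}"
proof
  define K where "K = (arcs X Y G H)\<^sup>* `` (S \<inter> X)"
  define C where "C = (X - K) \<union> (Y \<inter> K)"
  have disj: "X \<inter> Y = {}" and un: "X \<union> Y = UNIV"
    using bip by (simp_all add: bipartition_def)
  have closed: "v \<in> K" if "u \<in> K" "(u, v) \<in> arcs X Y G H" for u v
    using that unfolding K_def by (auto intro: rtrancl_into_rtrancl)
  have fwd: "x \<in> C \<or> y \<in> C" if "x \<in> X" "y \<in> Y" "{x, y} \<in> G" for x y
    using closed[of x y] that by (auto simp: C_def arcs_def)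
  have bwd: "x \<notin> C \<or> y \<notin> C" if "x \<in> X" "y \<in> Y" "{x, y} \<in> H" for x y
    using closed[of y x] that disj by (auto simp: C_def arcs_def)
  have edge: "\<exists>x\<in>X. \<exists>y\<in>Y. e = {x, y}" if "e \<in> G" for e
    using bip that by (simp add: bipartition_def)
  have "card (e \<inter> C) = 1" if e: "e \<in> H" for e
  proof -
    obtain x y where xy: "x \<in> X" "y \<in> Y" "e = {x, y}"
      using edge e HG by blast
    then have "e \<inter> C = {x} \<or> e \<inter> C = {y}"
      using fwd[of x y] bwd[of x y] e HG by auto
    then show ?thesis
      by auto
  qed
  moreover have "vertex_cover G C"
    unfolding vertex_cover_def
  proof
    fix e assume e: "e \<in> G"
    then obtain x y where "x \<in> X" "y \<in> Y" "e = {x, y}"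
      using edge by blast
    then show "e \<inter> C \<noteq> {}"
      using fwd[of x y] e by auto
  qed
  ultimately show "exact_cover G H C"
    by (simp add: exact_cover_def)
  have "x \<in> K" if "x \<in> S" "x \<in> X" for x
    using that by (auto simp: K_def)
  moreover have "y \<notin> S" if "y \<in> Y" "y \<in> K" for y
    using S that unfolding K_def connected_graph_def by blast
  ultimately show "C \<inter> S = {}"
    by (auto simp: C_def)
qed

section \<open>Minimal vertex covers\<close>

lemma minimal_vertex_cover_connected_graph:
  fixes G :: "'v::finite graph"
  assumes bip: "bipartition X Y G" and HG: "H \<subseteq> G"
    and min: "minimal_vertex_cover (connected_graph X Y G H) C"
  shows "minimal_vertex_cover G C"
proof -
  have cov: "vertex_cover (connected_graph X Y G H) C"
    and least: "\<And>B. vertex_cover (connected_graph X Y G H) B \<Longrightarrow> B \<subseteq> C \<Longrightarrow> B = C"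
    using min by (auto simp: minimal_vertex_cover_def)
  obtain B where B: "exact_cover G H B" "B \<inter> - C = {}"
    using exact_cover_avoiding[OF bip HG, of "- C"] cov unfolding vertex_cover_def by blast
  have "B = C"
    using least exact_cover_meets_connected[OF bip B(1)] B(2) by blast
  then have C: "exact_cover G H C"
    using B(1) by simp
  have "B = C" if B: "vertex_cover G B" "B \<subseteq> C" for B
  proof -
    have "card (e \<inter> B) = 1" if "e \<in> H" for e
    proof -
      have "card (e \<inter> B) \<le> card (e \<inter> C)"
        using B(2) by (intro card_mono) auto
      moreover have "e \<inter> B \<noteq> {}"
        using B(1) HG that by (auto simp: vertex_cover_def)
      then have "card (e \<inter> B) > 0"
        by (simp add: card_gt_0_iff)
      moreover have "card (e \<inter> C) = 1"
        using C that by (simp add: exact_cover_def)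
      ultimately show ?thesis
        by linarith
    qed
    then have "exact_cover G H B"
      using B(1) by (simp add: exact_cover_def)
    then show ?thesis
      using least exact_cover_meets_connected[OF bip] B(2) by blast
  qed
  then show ?thesis
    using C by (auto simp: minimal_vertex_cover_def exact_cover_def)
qed

corollary unmixed_connected_graph:
  fixes G :: "'v::finite graph"
  assumes "bipartition X Y G" "H \<subseteq> G" "unmixed G"
  shows "unmixed (connected_graph X Y G H)"
  using assms minimal_vertex_cover_connected_graph unfolding unmixed_def by meson

section \<open>The colon ideal\<close>

text \<open>
  The exchange along a path. If the path starts with \<open>x \<rightarrow> z \<rightarrow> x'\<close>, where \<open>z \<rightarrow> x'\<close> comes from
  \<open>e\<^sub>j = x'z\<close>, then \<open>xy e\<^sub>j = (xz) (x'y)\<close>, and the path from \<open>x'\<close> to \<open>y\<close> can be handled by the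
  remaining factors: a walk that returns to the arc \<open>z \<rightarrow> x'\<close> passes through \<open>x'\<close> again, so it can
  be shortened to avoid this arc.
\<close>

lemma connected_times_edges_in_products:
  fixes G :: "'v graph" and e :: "'i \<Rightarrow> 'v set"
  assumes disj: "X \<inter> Y = {}" and y: "y \<in> Y"
    and "finite I" "x \<in> X" "e ` I \<subseteq> G" "(x, y) \<in> (arcs X Y G (e ` I))\<^sup>*"
  shows "(edge_monomial {x, y} :: ('v, 'k::comm_ring_1) polynomial) * (\<Prod>i\<in>I. edge_monomial (e i))
    \<in> products (edge_monomial ` G) (Suc (card I))"
  using assms(3-)
proof (induction I arbitrary: x rule: finite_psubset_induct)
  case (psubset I)
  have "x \<noteq> y"
    using disj y psubset.prems(1) by auto
  then obtain z where xz: "(x, z) \<in> arcs X Y G (e ` I)" and zy: "(z, y) \<in> (arcs X Y G (e ` I))\<^sup>*"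
    using psubset.prems(3) by (meson converse_rtranclE)
  have z: "z \<in> Y" "{x, z} \<in> G"
    using xz disj psubset.prems(1) by (auto simp: arcs_def)
  show ?case
  proof (cases "z = y")
    case True
    then show ?thesis
      using z psubset.prems(2) psubset.hyps by (intro mult_in_products prod_in_products) auto
  next
    case False
    then obtain x' where zx': "(z, x') \<in> arcs X Y G (e ` I)"
      and x'y: "(x', y) \<in> (arcs X Y G (e ` I))\<^sup>*"
      using zy by (meson converse_rtranclE)
    then have x': "x' \<in> X" "{x', z} \<in> e ` I"
      using z disj by (auto simp: arcs_def)
    then obtain j where j: "j \<in> I" "e j = {x', z}"
      by auto
    let ?I = "I - {j}"
    have "e ` I = insert {x', z} (e ` ?I)"
      using j by auto
    then have "arcs X Y G (e ` I) \<subseteq> insert (z, x') (arcs X Y G (e ` ?I))"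
      using x' z disj by (auto simp: arcs_def doubleton_eq_iff)
    then have "(x', y) \<in> (insert (z, x') (arcs X Y G (e ` ?I)))\<^sup>*"
      using x'y rtrancl_mono by blast
    then have "(x', y) \<in> (arcs X Y G (e ` ?I))\<^sup>*"
      by (auto simp: rtrancl_insert)
    then have IH: "(edge_monomial {x', y} :: ('v, 'k) polynomial) * (\<Prod>i\<in>?I. edge_monomial (e i))
        \<in> products (edge_monomial ` G) (Suc (card ?I))"
      using j x' psubset.prems(2) by (intro psubset.IH) auto
    have "x \<noteq> z" "x' \<noteq> y" "x' \<noteq> z"
      using disj y z x' psubset.prems(1) by auto
    then have "(edge_monomial {x, y} :: ('v, 'k) polynomial) * edge_monomial (e j)
        = edge_monomial {x, z} * edge_monomial {x', y}"
      using \<open>x \<noteq> y\<close> j by (simp add: edge_monomial_def mult_ac)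
    then have "(edge_monomial {x, y} :: ('v, 'k) polynomial) * (\<Prod>i\<in>I. edge_monomial (e i))
        = edge_monomial {x, z} * (edge_monomial {x', y} * (\<Prod>i\<in>?I. edge_monomial (e i)))"
      using psubset.hyps j(1) by (simp add: prod.remove[of I j] flip: mult.assoc)
    moreover have "Suc (card ?I) = card I"
      using psubset.hyps j(1) by (intro card_Suc_Diff1)
    ultimately show ?thesis
      using mult_in_products[OF _ IH, of "edge_monomial {x, z}"] z by simp
  qed
qed

theorem colon_ideal_power_edge_ideal:
  fixes G :: "'v::finite graph" and e :: "'i \<Rightarrow> 'v set"
  assumes bip: "bipartition X Y G" and I: "finite I" "e ` I \<subseteq> G"
  shows "colon_ideal (ideal_power (edge_ideal G) (card I + 1)) (\<Prod>i\<in>I. edge_monomial (e i))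
    = (edge_ideal (connected_graph X Y G (e ` I)) :: ('v, 'k::comm_ring_1) polynomial set)"
    (is "?J = edge_ideal ?G'")
proof
  let ?m = "\<Prod>i\<in>I. edge_monomial (e i) :: ('v, 'k) polynomial"
  have disj: "X \<inter> Y = {}"
    using bip by (simp add: bipartition_def)
  show "edge_ideal ?G' \<subseteq> ?J"
    unfolding edge_ideal_def[of ?G']
  proof (rule generated_ideal_minimal)
    show "edge_monomial ` ?G' \<subseteq> ?J"
    proof
      fix p :: "('v, 'k) polynomial" assume "p \<in> edge_monomial ` ?G'"
      then obtain x y where xy: "p = edge_monomial {x, y}" "x \<in> X" "y \<in> Y"
        "(x, y) \<in> (arcs X Y G (e ` I))\<^sup>*"
        by (auto simp: connected_graph_def)
      have "p * ?m \<in> products (edge_monomial ` G) (card I + 1)"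
        using connected_times_edges_in_products[OF disj xy(3) I(1) xy(2) I(2) xy(4)] xy(1) by simp
      moreover have "edge_monomial ` G \<subseteq> (edge_ideal G :: ('v, 'k) polynomial set)"
        by (auto simp: edge_ideal_def intro: generated_ideal_base)
      ultimately have "p * ?m \<in> ideal_power (edge_ideal G) (card I + 1)"
        unfolding ideal_power_alt by (meson generated_ideal_base products_mono subsetD)
      then show "p \<in> ?J"
        by (simp add: colon_ideal_def)
    qed
  qed (auto simp: colon_ideal_def ideal_power_alt distrib_right mult.assoc
        intro: generated_ideal_zero generated_ideal_add generated_ideal_mult)
  show "?J \<subseteq> edge_ideal ?G'"
  proof
    fix p assume "p \<in> ?J"
    then have pm: "p * ?m \<in> ideal_power (edge_ideal G) (card I + 1)"
      by (simp add: colon_ideal_def)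
    define u where "u = (\<Sum>i\<in>I. edge_exponent (e i))"
    have m: "?m = Poly_Mapping.single u 1"
      by (simp add: u_def edge_monomial_eq_single prod_single)
    have "\<exists>f\<in>?G'. f \<subseteq> Poly_Mapping.keys t" if t: "t \<in> Poly_Mapping.keys p" for t
    proof (rule ccontr)
      assume "\<not> ?thesis"
      then obtain C where C: "exact_cover G (e ` I) C" "C \<inter> Poly_Mapping.keys t = {}"
        using exact_cover_avoiding[OF bip I(2), of "Poly_Mapping.keys t"] by blast
      have "p * ?m \<in> weight_at_least C (card I + 1)"
        using C(1) pm ideal_power_edge_ideal_weight_at_least by (auto simp: exact_cover_def)
      then have "card I + 1 \<le> weight C (t + u)"
        using keys_mult_monomial[OF t, of u] unfolding m weight_at_least_def by blast
      moreover have "weight C u = card I"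
        using C(1) by (simp add: u_def weight_sum weight_edge_exponent exact_cover_def)
      moreover have "weight C t = 0"
        using C(2) by (auto simp: weight_def in_keys_iff)
      ultimately show False
        by (simp add: weight_add)
    qed
    then show "p \<in> edge_ideal ?G'"
      by (simp add: mem_edge_ideal_iff)
  qed
qed

theorem theorem4p1:
  fixes G :: "'v::finite graph"
    and e :: "nat \<Rightarrow> 'v set"
    and s :: nat
    and J :: "('v, 'k::field) polynomial set"
  assumes "simple_graph G" and "bipartite G" and "unmixed G"
    and "s \<ge> 1"
    and "\<forall>i\<in>{1..s}. e i \<in> G"
    and "J = colon_ideal (ideal_power (edge_ideal G) (s + 1)) (\<Prod>i=1..s. edge_monomial (e i))"
  shows "(\<exists>!G'. associated_graph J G') \<and>
         (\<forall>G'. associated_graph J G' \<longrightarrow> unmixed G' \<and> bipartite G')"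
proof -
  obtain X Y where bip: "bipartition X Y G"
    using assms(2) unfolding bipartite_def bipartition_def by blast
  have e: "e ` {1..s} \<subseteq> G"
    using assms(5) by blast
  define G' where "G' = connected_graph X Y G (e ` {1..s})"
  have bip': "bipartition X Y G'"
    unfolding G'_def by (rule bipartition_connected_graph[OF bip])
  have J: "edge_ideal G' = J"
    using colon_ideal_power_edge_ideal[where 'k = 'k, OF bip _ e] assms(6) by (simp add: G'_def)
  have ass: "associated_graph J F \<longleftrightarrow> F = G'" for F
    using J bipartition_imp_simple_graph[OF bip'] edge_ideal_inject[where 'k = 'k]
    unfolding associated_graph_def by metis
  have "unmixed G'"
    unfolding G'_def by (rule unmixed_connected_graph[OF bip e assms(3)])
  moreover have "bipartite G'"
    using bip' unfolding bipartite_def bipartition_def by blast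
  ultimately show ?thesis
    by (simp add: ass)
qed

end
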